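(* As $\alpha\uparrow1/2$ through $0<\alpha<1/2$, $$\Lambda_2(\alpha,0)=C_{2,0}\sqrt{1-2\alpha}\,\bigl[1+O(1-2\alpha)\bigr],\qquad C_{2,0}=\lambda_*/2.$$
   Context: For $0<\alpha<1$ let $K_\alpha$ be the operator on $L^2(0,1)$ given by $K_\alpha f(x)=\int_0^1|x-y|^{-\alpha}f(y)\,dy$. Put $K_*=K_{1/2}$, a bounded, compact, positive operator (not Hilbert--Schmidt), and let $\lambda_*=\lambda_{\max}(K_* )$ be its leading eigenvalue. For $0<\alpha<1/2$ the unweighted rank-two LIL constant is $$\Lambda_2(\alpha,0)=\frac{\lambda_{\max}(K_\alpha)}{\sqrt{2\operatorname{tr}(K_\alpha^2)}},\qquad \operatorname{tr}(K_\alpha^2)=\int_0^1\!\!\int_0^1|x-y|^{-2\alpha}\,dx\,dy .$$ *)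

theory Defs
  imports "HOL-Analysis.Analysis" "HOL-Library.Landau_Symbols"
begin

abbreviation unit_measure :: "real measure" where
  "unit_measure \<equiv> lebesgue_on {0<..<1}"

text \<open>Real square-integrable functions on the open unit interval. Elements are functions, not
  classes modulo null sets, so equality in the Hilbert space is equality almost everywhere.
  The operators considered are self-adjoint, so real scalars lose no eigenvalue.\<close>

definition L2_unit :: "(real \<Rightarrow> real) set" where
  "L2_unit = {f \<in> borel_measurable unit_measure. integrable unit_measure (\<lambda>x. (f x)\<^sup>2)}"

definition L2_eigenvalue :: "((real \<Rightarrow> real) \<Rightarrow> real \<Rightarrow> real) \<Rightarrow> real \<Rightarrow> bool" where
  "L2_eigenvalue T l \<longleftrightarrow>
     (\<exists>f\<in>L2_unit. \<not> (AE x in unit_measure. f x = 0) \<and> (AE x in unit_measure. T f x = l * f x))"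

definition lambda_max :: "((real \<Rightarrow> real) \<Rightarrow> real \<Rightarrow> real) \<Rightarrow> real" where
  "lambda_max T = (GREATEST l. L2_eigenvalue T l)"

text \<open>On the diagonal the kernel takes the value \<open>0 powr (- \<alpha>) = 0\<close>, which affects only a null set.
  For \<open>0 < \<alpha> < 1\<close> and square-integrable \<open>f\<close> the integral converges absolutely for almost every \<open>x\<close>;
  at the remaining points it has the default value \<open>0\<close>.\<close>

definition K_op :: "real \<Rightarrow> (real \<Rightarrow> real) \<Rightarrow> real \<Rightarrow> real" where
  "K_op \<alpha> f x = (\<integral>y. \<bar>x - y\<bar> powr (- \<alpha>) * f y \<partial>unit_measure)"

definition trace_K_sq :: "real \<Rightarrow> real" where
  "trace_K_sq \<alpha> = (\<integral>y. (\<integral>x. \<bar>x - y\<bar> powr (- 2 * \<alpha>) \<partial>unit_measure) \<partial>unit_measure)"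

text \<open>The constant \<open>\<Lambda>\<^sub>2(\<alpha>, 0)\<close>; the second argument \<open>0\<close> is the unweighted case.\<close>

definition Lambda2_unweighted :: "real \<Rightarrow> real" where
  "Lambda2_unweighted \<alpha> = lambda_max (K_op \<alpha>) / sqrt (2 * trace_K_sq \<alpha>)"

definition lambda_star :: real where
  "lambda_star = lambda_max (K_op (1/2))"

definition C20 :: real where
  "C20 = lambda_star / 2"

end

theory Submission
  imports Defs
begin

text \<open>The double integral is elementary, \<open>trace_K_sq \<alpha> = 1 / ((1 - 2\<alpha>) (1 - \<alpha>))\<close>, so
  \<open>Lambda2_unweighted \<alpha> = lambda_max (K_op \<alpha>) * sqrt (1 - 2\<alpha>) * sqrt (2 (1 - \<alpha>)) / 2\<close>, and
  \<open>sqrt (2 (1 - \<alpha>)) = 1 + O(1 - 2\<alpha>)\<close>. Everything therefore rests on two facts about the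
  leading eigenvalue: it exists and is positive for \<open>0 < \<alpha> \<le> 1/2\<close>, and it is Lipschitz in \<open>\<alpha>\<close> at
  \<open>1/2\<close>.

  Existence uses the Perron--Frobenius property in place of the spectral theorem. On the unit interval
  the kernel is at least \<open>1\<close>, and it is bounded by a constant plus a kernel of small row integrals.
  Iterates \<open>f\<^sub>n\<close> of the constant function \<open>1\<close> hence stay comparable to their means. This forces
  the pointwise bounds on the quotients \<open>f\<^sub>n\<^sub>+\<^sub>1 / f\<^sub>n\<close> together at a geometric rate, as in
  Birkhoff's contraction theorem, and the suitably scaled iterates increase to a bounded
  eigenfunction \<open>u \<ge> 1\<close> (\<open>positive_eigenfunction\<close>). Pairing the absolute value of any other
  eigenfunction with \<open>u\<close> shows that the eigenvalue of \<open>u\<close> is the largest one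
  (\<open>eigenvalue_le\<close>).

  For the Lipschitz bound, let \<open>u\<close> and \<open>v\<close> be the positive eigenfunctions for \<open>\<alpha>\<close> and \<open>1/2\<close>.
  By symmetry of \<open>K_op \<alpha>\<close>, the difference of the eigenvalues times \<open>\<integral> u v\<close> equals
  \<open>\<integral> u (K_op (1/2) v - K_op \<alpha> v)\<close>. The inner difference lies between \<open>0\<close> and
  a constant times \<open>1 - 2\<alpha>\<close>, because
  \<open>0 \<le> t powr (-1/2) - t powr (-\<alpha>) \<le> 2 (1 - 2\<alpha>) t powr (-3/4)\<close> on \<open>[0, 1]\<close>. The constant
  involves only the upper bound of the fixed function \<open>v\<close>, so it is uniform in \<open>\<alpha>\<close>
  (\<open>lambda_max_lipschitz\<close>).\<close>

section \<open>Bounded measurable functions\<close>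

definition bounded_fun :: "'a measure \<Rightarrow> ('a \<Rightarrow> real) \<Rightarrow> bool" where
  "bounded_fun M f \<longleftrightarrow> f \<in> borel_measurable M \<and> (\<exists>C. \<forall>x\<in>space M. \<bar>f x\<bar> \<le> C)"

lemma bounded_funI:
  assumes "f \<in> borel_measurable M" "\<And>x. x \<in> space M \<Longrightarrow> \<bar>f x\<bar> \<le> C"
  shows "bounded_fun M f"
  using assms unfolding bounded_fun_def by blast

lemma bounded_fun_measurable: "bounded_fun M f \<Longrightarrow> f \<in> borel_measurable M"
  unfolding bounded_fun_def by blast

lemma (in finite_measure) integrable_bounded_fun: "bounded_fun M f \<Longrightarrow> integrable M f"
  unfolding bounded_fun_def by (metis AE_I2 integrable_const_bound real_norm_def)

lemma bounded_fun_diff_cmult: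
  assumes "bounded_fun M f" "bounded_fun M g"
  shows "bounded_fun M (\<lambda>x. a * f x - b * g x)"
proof -
  obtain C D where C: "\<forall>x\<in>space M. \<bar>f x\<bar> \<le> C" and D: "\<forall>x\<in>space M. \<bar>g x\<bar> \<le> D"
    using assms unfolding bounded_fun_def by blast
  show ?thesis
  proof (rule bounded_funI)
    show "(\<lambda>x. a * f x - b * g x) \<in> borel_measurable M"
      using assms[THEN bounded_fun_measurable] by measurable
    fix x assume "x \<in> space M"
    then have "\<bar>a * f x\<bar> \<le> \<bar>a\<bar> * C" "\<bar>b * g x\<bar> \<le> \<bar>b\<bar> * D"
      using C D by (auto simp: abs_mult intro!: mult_left_mono)
    then show "\<bar>a * f x - b * g x\<bar> \<le> \<bar>a\<bar> * C + \<bar>b\<bar> * D" by linarith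
  qed
qed

lemma bounded_fun_mult:
  assumes "bounded_fun M f" "bounded_fun M g"
  shows "bounded_fun M (\<lambda>x. f x * g x)"
proof -
  obtain C D where C: "\<forall>x\<in>space M. \<bar>f x\<bar> \<le> C" and D: "\<forall>x\<in>space M. \<bar>g x\<bar> \<le> D"
    using assms unfolding bounded_fun_def by blast
  show ?thesis
  proof (rule bounded_funI)
    show "(\<lambda>x. f x * g x) \<in> borel_measurable M"
      using assms[THEN bounded_fun_measurable] by measurable
    show "\<bar>f x * g x\<bar> \<le> C * D" if "x \<in> space M" for x
      unfolding abs_mult using C D that
      by (intro mult_mono) (auto intro: order_trans[OF abs_ge_zero])
  qed
qed

section \<open>Positive eigenfunctions by power iteration\<close>

text \<open>The decomposition \<open>k \<le> q + A\<close> takes the place of boundedness of the kernel: the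
  operator with kernel \<open>q\<close> is a contraction by \<open>1/2\<close> in the supremum norm, while the bounded part
  \<open>A\<close> only sees the mean of a function. The lower bound \<open>1\<close> is demanded almost everywhere in each row,
  since a singular kernel may carry an arbitrary value on the diagonal.\<close>

locale bounded_below_kernel = finite_measure M for M :: "'a measure" +
  fixes k q :: "'a \<Rightarrow> 'a \<Rightarrow> real" and A :: real
  assumes mass: "measure M (space M) = 1"
    and kernel_measurable [measurable]: "case_prod k \<in> borel_measurable (M \<Otimes>\<^sub>M M)"
    and kernel_sym: "\<And>x y. k x y = k y x"
    and kernel_ge: "\<And>x. x \<in> space M \<Longrightarrow> AE y in M. 1 \<le> k x y"
    and kernel_le: "\<And>x y. x \<in> space M \<Longrightarrow> y \<in> space M \<Longrightarrow> k x y \<le> q x y + A"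
    and q_integrable: "\<And>x. x \<in> space M \<Longrightarrow> integrable M (q x)"
    and q_nonneg: "\<And>x y. 0 \<le> q x y"
    and q_small: "\<And>x. x \<in> space M \<Longrightarrow> (\<integral>y. q x y \<partial>M) \<le> 1 / 2"
    and A_ge: "1 \<le> A"
begin

definition apply_kernel :: "('a \<Rightarrow> real) \<Rightarrow> 'a \<Rightarrow> real" where
  "apply_kernel f x = (\<integral>y. k x y * f y \<partial>M)"

lemma kernel_section_measurable [measurable]:
  "x \<in> space M \<Longrightarrow> k x \<in> borel_measurable M"
  using measurable_compose[OF measurable_Pair1' kernel_measurable] by simp

lemma kernel_integrable:
  assumes x: "x \<in> space M"
  shows "integrable M (k x)"
proof (rule Bochner_Integration.integrable_bound)
  show "integrable M (\<lambda>y. q x y + A)" using q_integrable[OF x] by simp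
  show "AE y in M. norm (k x y) \<le> norm (q x y + A)"
    using kernel_ge[OF x] AE_space by eventually_elim (use kernel_le[OF x] in fastforce)
qed (use x in measurable)

lemma kernel_mult_integrable:
  assumes x: "x \<in> space M" and f: "bounded_fun M f"
  shows "integrable M (\<lambda>y. k x y * f y)"
proof -
  obtain C where C: "\<forall>x\<in>space M. \<bar>f x\<bar> \<le> C" using f unfolding bounded_fun_def by blast
  have [measurable]: "f \<in> borel_measurable M" using f by (rule bounded_fun_measurable)
  show ?thesis
  proof (rule Bochner_Integration.integrable_bound)
    show "integrable M (\<lambda>y. k x y * C)" using kernel_integrable[OF x] by simp
    show "AE y in M. norm (k x y * f y) \<le> norm (k x y * C)"
      using AE_space by eventually_elim (use C in \<open>force simp: abs_mult intro!: mult_left_mono\<close>)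
  qed (use x in measurable)
qed

lemma apply_kernel_diff_cmult:
  assumes x: "x \<in> space M" and f: "bounded_fun M f" and g: "bounded_fun M g"
  shows "apply_kernel (\<lambda>y. a * f y - b * g y) x = a * apply_kernel f x - b * apply_kernel g x"
proof -
  have "apply_kernel (\<lambda>y. a * f y - b * g y) x = (\<integral>y. a * (k x y * f y) - b * (k x y * g y) \<partial>M)"
    unfolding apply_kernel_def by (simp add: algebra_simps)
  also have "\<dots> = a * apply_kernel f x - b * apply_kernel g x"
    unfolding apply_kernel_def using kernel_mult_integrable[OF x f] kernel_mult_integrable[OF x g] by simp
  finally show ?thesis .
qed

lemma apply_kernel_ge_integral:
  assumes x: "x \<in> space M" and f: "bounded_fun M f" and nn: "\<And>y. y \<in> space M \<Longrightarrow> 0 \<le> f y"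
  shows "(\<integral>y. f y \<partial>M) \<le> apply_kernel f x"
  unfolding apply_kernel_def
proof (rule integral_mono_AE[OF integrable_bounded_fun[OF f] kernel_mult_integrable[OF x f]])
  show "AE y in M. f y \<le> k x y * f y"
    using kernel_ge[OF x] AE_space
    by eventually_elim (use nn in \<open>simp add: mult_le_cancel_right1 leD\<close>)
qed

text \<open>The constant \<open>2 A\<close> is the fixed point of \<open>c \<mapsto> c / 2 + A\<close>, which is how a bound of \<open>f\<close> by
  \<open>c\<close> times its mean is transformed: \<open>q\<close> contributes \<open>c / 2\<close> and the constant part contributes \<open>A\<close>.\<close>

lemma apply_kernel_le_integral:
  assumes x: "x \<in> space M" and f: "bounded_fun M f" and nn: "\<And>y. y \<in> space M \<Longrightarrow> 0 \<le> f y"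
    and le: "\<And>y. y \<in> space M \<Longrightarrow> f y \<le> 2 * A * (\<integral>z. f z \<partial>M)"
  shows "apply_kernel f x \<le> 2 * A * (\<integral>z. f z \<partial>M)"
proof -
  let ?I = "\<integral>z. f z \<partial>M"
  have I: "0 \<le> ?I" using nn by (intro integral_nonneg_AE) auto
  have "apply_kernel f x \<le> (\<integral>y. q x y * (2 * A * ?I) + A * f y \<partial>M)"
    unfolding apply_kernel_def
  proof (rule integral_mono[OF kernel_mult_integrable[OF x f]])
    show "integrable M (\<lambda>y. q x y * (2 * A * ?I) + A * f y)"
      using q_integrable[OF x] integrable_bounded_fun[OF f] by simp
    fix y assume y: "y \<in> space M"
    have "k x y * f y \<le> (q x y + A) * f y"
      using kernel_le[OF x y] nn[OF y] by (rule mult_right_mono)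
    also have "\<dots> = q x y * f y + A * f y" by (simp add: algebra_simps)
    also have "\<dots> \<le> q x y * (2 * A * ?I) + A * f y"
      using mult_left_mono[OF le[OF y] q_nonneg] by simp
    finally show "k x y * f y \<le> q x y * (2 * A * ?I) + A * f y" .
  qed
  also have "\<dots> = (\<integral>y. q x y \<partial>M) * (2 * A * ?I) + A * ?I"
    using q_integrable[OF x] integrable_bounded_fun[OF f] by simp
  also have "\<dots> \<le> 1 / 2 * (2 * A * ?I) + A * ?I"
    using A_ge I q_small[OF x] by (intro add_right_mono mult_right_mono) auto
  finally show ?thesis by simp
qed

lemma apply_kernel_measurable [measurable]:
  assumes [measurable]: "f \<in> borel_measurable M"
  shows "apply_kernel f \<in> borel_measurable M"
  unfolding apply_kernel_def[abs_def] by measurable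

primrec iter :: "nat \<Rightarrow> 'a \<Rightarrow> real" where
  "iter 0 = (\<lambda>x. 1)"
| "iter (Suc n) = apply_kernel (iter n)"

text \<open>Since the mean does not decrease under the operator, the bound by \<open>2 A\<close> times the mean passes
  from each iterate to the next.\<close>

lemma iter_bounds:
  "bounded_fun M (iter n) \<and> (\<forall>x\<in>space M. 0 < iter n x \<and> iter n x \<le> 2 * A * (\<integral>y. iter n y \<partial>M))
     \<and> 1 \<le> (\<integral>y. iter n y \<partial>M)"
proof (induction n)
  case 0
  then show ?case using mass A_ge by (auto intro!: bounded_funI[where C=1])
next
  case (Suc n)
  let ?f = "iter n" and ?I = "\<integral>y. iter n y \<partial>M"
  have f: "bounded_fun M ?f" and pos: "\<And>x. x \<in> space M \<Longrightarrow> 0 \<le> ?f x"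
    and le: "\<And>x. x \<in> space M \<Longrightarrow> ?f x \<le> 2 * A * ?I" and I: "1 \<le> ?I"
    using Suc.IH by (auto simp: less_imp_le)
  have ge': "?I \<le> apply_kernel ?f x" and le': "apply_kernel ?f x \<le> 2 * A * ?I" if "x \<in> space M" for x
    using apply_kernel_ge_integral[OF that f pos] apply_kernel_le_integral[OF that f pos le] by auto
  have b: "bounded_fun M (apply_kernel ?f)"
    using ge' le' I bounded_fun_measurable[OF f]
    by (intro bounded_funI[where C="2 * A * ?I"] apply_kernel_measurable) force+
  have "(\<integral>y. ?I \<partial>M) \<le> (\<integral>y. apply_kernel ?f y \<partial>M)"
    using ge' integrable_bounded_fun[OF b] by (intro integral_mono) auto
  then have mono: "?I \<le> (\<integral>y. apply_kernel ?f y \<partial>M)" using mass by simp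
  have "apply_kernel ?f x \<le> 2 * A * (\<integral>y. apply_kernel ?f y \<partial>M)" if "x \<in> space M" for x
    using le'[OF that] mult_left_mono[OF mono, of "2 * A"] A_ge by linarith
  then show ?case using b ge' I mono by force
qed

lemma bounded_iter: "bounded_fun M (iter n)"
  and iter_pos: "x \<in> space M \<Longrightarrow> 0 < iter n x"
  and iter_le: "x \<in> space M \<Longrightarrow> iter n x \<le> 2 * A * (\<integral>y. iter n y \<partial>M)"
  and integral_iter_ge: "1 \<le> (\<integral>y. iter n y \<partial>M)"
  using iter_bounds[of n] by auto

lemma iter_Suc_le: "x \<in> space M \<Longrightarrow> iter (Suc n) x \<le> 2 * A * (\<integral>y. iter n y \<partial>M)"
  using apply_kernel_le_integral[OF _ bounded_iter, of x n] iter_pos iter_le by (simp add: less_imp_le)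

definition mean_ratio :: "nat \<Rightarrow> real" where
  "mean_ratio n = (\<integral>y. iter (Suc n) y \<partial>M) / (\<integral>y. iter n y \<partial>M)"

text \<open>Pointwise lower and upper bounds for the quotient of two successive iterates. Each step moves
  both bounds towards the quotient of the means by the fraction \<open>1 / (2 A)\<close> of their distance to it,
  which makes their difference an exact geometric sequence.\<close>

primrec lower :: "nat \<Rightarrow> real" where
  "lower 0 = 1"
| "lower (Suc n) = lower n + (mean_ratio n - lower n) / (2 * A)"

primrec upper :: "nat \<Rightarrow> real" where
  "upper 0 = 2 * A"
| "upper (Suc n) = upper n - (upper n - mean_ratio n) / (2 * A)"

text \<open>The operator maps a nonnegative \<open>h\<close> to a function that is at least \<open>\<integral> h\<close>, and this mean is
  comparable to the next iterate because the iterates are bounded by their means. Hence a pointwise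
  inequality between multiples of two successive iterates becomes strictly better after one step.
  The scalars \<open>(a, b) = (1, lower n)\<close> and \<open>(-1, - upper n)\<close> give the two improvements used below.\<close>

lemma ratio_improve:
  assumes x: "x \<in> space M"
    and nn: "\<And>y. y \<in> space M \<Longrightarrow> 0 \<le> a * iter (Suc n) y - b * iter n y"
  shows "(a * mean_ratio n - b) / (2 * A) * iter (Suc n) x
           \<le> a * iter (Suc (Suc n)) x - b * iter (Suc n) x"
proof -
  let ?I = "\<integral>y. iter n y \<partial>M" and ?J = "\<integral>y. iter (Suc n) y \<partial>M"
  let ?h = "\<lambda>y. a * iter (Suc n) y - b * iter n y"
  have I: "1 \<le> ?I" by (rule integral_iter_ge)
  have int: "(\<integral>y. ?h y \<partial>M) = a * ?J - b * ?I"
    using integrable_bounded_fun[OF bounded_iter] by (simp del: iter.simps)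
  have eq: "a * ?J - b * ?I = (a * mean_ratio n - b) * ?I"
    unfolding mean_ratio_def using I by (simp add: field_simps)
  have "0 \<le> (\<integral>y. ?h y \<partial>M)" using nn by (intro integral_nonneg_AE) auto
  then have c: "0 \<le> a * mean_ratio n - b" using I unfolding int eq by (simp add: zero_le_mult_iff)
  have "(a * mean_ratio n - b) / (2 * A) * iter (Suc n) x
          \<le> (a * mean_ratio n - b) / (2 * A) * (2 * A * ?I)"
    using iter_Suc_le[OF x] c A_ge by (intro mult_left_mono) auto
  also have "\<dots> = (\<integral>y. ?h y \<partial>M)" unfolding int eq using A_ge by simp
  also have "\<dots> \<le> apply_kernel ?h x"
    using apply_kernel_ge_integral[OF x bounded_fun_diff_cmult[OF bounded_iter bounded_iter] nn] .
  also have "\<dots> = a * iter (Suc (Suc n)) x - b * iter (Suc n) x"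
    using apply_kernel_diff_cmult[OF x bounded_iter[of "Suc n"] bounded_iter[of n]] by simp
  finally show ?thesis .
qed

lemma ratio_bounds:
  "\<forall>x\<in>space M. lower n * iter n x \<le> iter (Suc n) x \<and> iter (Suc n) x \<le> upper n * iter n x"
proof (induction n)
  case 0
  then show ?case
    using apply_kernel_ge_integral[OF _ bounded_iter, of _ 0] iter_Suc_le[of _ 0] mass by simp
next
  case (Suc n)
  show ?case
  proof
    fix x assume x: "x \<in> space M"
    have "lower (Suc n) * iter (Suc n) x \<le> iter (Suc (Suc n)) x"
      using ratio_improve[OF x, of 1 n "lower n"] Suc.IH by (simp add: algebra_simps del: iter.simps)
    moreover have "iter (Suc (Suc n)) x \<le> upper (Suc n) * iter (Suc n) x"
      using ratio_improve[OF x, of "-1" n "- upper n"] Suc.IH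
      by (simp add: algebra_simps diff_divide_distrib del: iter.simps)
    ultimately show "lower (Suc n) * iter (Suc n) x \<le> iter (Suc (Suc n)) x \<and>
        iter (Suc (Suc n)) x \<le> upper (Suc n) * iter (Suc n) x" ..
  qed
qed

lemma mean_ratio_bounds: "lower n \<le> mean_ratio n" "mean_ratio n \<le> upper n"
proof -
  let ?I = "\<integral>y. iter n y \<partial>M"
  have I: "1 \<le> ?I" by (rule integral_iter_ge)
  note i = integrable_bounded_fun[OF bounded_iter]
  have "(\<integral>y. lower n * iter n y \<partial>M) \<le> (\<integral>y. iter (Suc n) y \<partial>M)"
    using i ratio_bounds[of n] by (intro integral_mono) (auto simp del: iter.simps)
  moreover have "(\<integral>y. iter (Suc n) y \<partial>M) \<le> (\<integral>y. upper n * iter n y \<partial>M)"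
    using i ratio_bounds[of n] by (intro integral_mono) (auto simp del: iter.simps)
  ultimately show "lower n \<le> mean_ratio n" "mean_ratio n \<le> upper n"
    using I unfolding mean_ratio_def by (auto simp: field_simps simp del: iter.simps)
qed

lemma upper_minus_lower: "upper n - lower n = (2 * A - 1) * (1 - 1 / (2 * A)) ^ n"
proof (induction n)
  case (Suc n)
  have "upper (Suc n) - lower (Suc n) = (upper n - lower n) * (1 - 1 / (2 * A))"
    using A_ge by (simp add: field_simps)
  then show ?case using Suc.IH by simp
qed simp

lemma lower_mono: "incseq lower"
  using mean_ratio_bounds A_ge by (intro incseq_SucI) simp

lemma upper_mono: "decseq upper"
  using mean_ratio_bounds A_ge by (intro decseq_SucI) simp

lemma lower_ge_1: "1 \<le> lower n"
  using incseqD[OF lower_mono, of 0 n] by simp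

text \<open>Scaling by the lower bounds, rather than by powers of the eigenvalue, makes the sequence
  increasing, so that its pointwise limit exists and stays at least \<open>1\<close>.\<close>

definition normalised :: "nat \<Rightarrow> 'a \<Rightarrow> real" where
  "normalised n x = iter n x / (\<Prod>i<n. lower i)"

lemma prod_lower_pos: "0 < (\<Prod>i<n. lower i)"
  using lower_ge_1 by (intro prod_pos) (auto intro: less_le_trans[OF zero_less_one])

lemma normalised_step:
  assumes x: "x \<in> space M"
  shows "normalised n x \<le> normalised (Suc n) x"
    and "normalised (Suc n) x \<le> (1 + (2 * A - 1) * (1 - 1 / (2 * A)) ^ n) * normalised n x"
proof -
  let ?P = "\<Prod>i<n. lower i"
  have P: "0 < ?P" by (rule prod_lower_pos)
  have l: "1 \<le> lower n" by (rule lower_ge_1)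
  have eq: "normalised (Suc n) x = iter (Suc n) x / lower n / ?P"
    unfolding normalised_def using P l by (simp add: field_simps)
  have "iter n x \<le> iter (Suc n) x / lower n"
    using ratio_bounds[of n] x l by (simp add: field_simps del: iter.simps)
  then show "normalised n x \<le> normalised (Suc n) x"
    unfolding eq unfolding normalised_def using P by (intro divide_right_mono) auto
  have d: "0 \<le> upper n - lower n" using mean_ratio_bounds[of n] by simp
  have "iter (Suc n) x \<le> upper n * iter n x" using ratio_bounds x by blast
  also have "\<dots> \<le> lower n * (1 + (upper n - lower n)) * iter n x"
  proof (rule mult_right_mono)
    have "0 \<le> (lower n - 1) * (upper n - lower n)" using d l by (intro mult_nonneg_nonneg) auto
    then show "upper n \<le> lower n * (1 + (upper n - lower n))" by (simp add: algebra_simps)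
  qed (use iter_pos[OF x] in \<open>auto simp: less_imp_le\<close>)
  finally have "iter (Suc n) x / lower n \<le> (1 + (upper n - lower n)) * iter n x"
    using l by (simp add: field_simps del: iter.simps)
  then have "iter (Suc n) x / lower n / ?P \<le> (1 + (upper n - lower n)) * iter n x / ?P"
    using P by (intro divide_right_mono) auto
  then show "normalised (Suc n) x \<le> (1 + (2 * A - 1) * (1 - 1 / (2 * A)) ^ n) * normalised n x"
    unfolding eq upper_minus_lower[symmetric] by (simp add: normalised_def)
qed

text \<open>One step multiplies by at most \<open>1 + (2 A - 1) t ^ n\<close> with \<open>t = 1 - 1 / (2 A)\<close>, and the product of
  these factors is at most the exponential of the geometric series.\<close>

lemma normalised_le:
  assumes x: "x \<in> space M"
  shows "normalised n x \<le> exp ((2 * A - 1) * (2 * A))"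
proof -
  let ?c = "2 * A - 1" and ?t = "1 - 1 / (2 * A)"
  have t: "0 \<le> ?t" "?t < 1" using A_ge by (auto simp: field_simps)
  have c: "0 \<le> ?c" using A_ge by simp
  have "normalised n x \<le> exp (\<Sum>i<n. ?c * ?t ^ i)"
  proof (induction n)
    case (Suc n)
    have "normalised (Suc n) x \<le> (1 + ?c * ?t ^ n) * normalised n x"
      by (rule normalised_step(2)[OF x])
    also have "\<dots> \<le> exp (?c * ?t ^ n) * exp (\<Sum>i<n. ?c * ?t ^ i)"
    proof (rule mult_mono)
      show "1 + ?c * ?t ^ n \<le> exp (?c * ?t ^ n)" by (rule exp_ge_add_one_self)
      show "0 \<le> normalised n x"
        unfolding normalised_def using iter_pos[OF x] prod_lower_pos by (simp add: less_imp_le)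
    qed (use Suc.IH in auto)
    finally show ?case by (simp add: exp_add mult.commute)
  qed (simp add: normalised_def)
  also have "\<dots> \<le> exp (?c * (2 * A))"
  proof -
    have "(\<Sum>i<n. ?t ^ i) \<le> (\<Sum>i. ?t ^ i)"
      using t by (intro sum_le_suminf summable_geometric) auto
    also have "\<dots> = 2 * A" using t A_ge by (subst suminf_geometric) auto
    finally show ?thesis using c by (simp add: sum_distrib_left[symmetric] mult_left_mono)
  qed
  finally show ?thesis .
qed

lemma apply_kernel_normalised:
  assumes "x \<in> space M"
  shows "apply_kernel (normalised n) x = lower n * normalised (Suc n) x"
proof -
  have "apply_kernel (normalised n) x = apply_kernel (iter n) x / (\<Prod>i<n. lower i)"
    unfolding apply_kernel_def normalised_def by simp
  then show ?thesis
    unfolding normalised_def using lower_ge_1[of n] by simp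
qed

text \<open>The scaled iterates increase to a bounded limit, and dominated convergence carries
  \<open>apply_kernel (normalised n) = lower n * normalised (n + 1)\<close> over to it. The eigenvalue is the limit
  of the lower bounds.\<close>

lemma positive_eigenfunction:
  obtains u l where "bounded_fun M u" "\<And>x. x \<in> space M \<Longrightarrow> 1 \<le> u x"
    "\<And>x. x \<in> space M \<Longrightarrow> apply_kernel u x = l * u x" "1 \<le> l"
proof -
  define G where "G = exp ((2 * A - 1) * (2 * A))"
  define u where "u x = lim (\<lambda>n. normalised n x)" for x
  have inc: "incseq (\<lambda>n. normalised n x)" if "x \<in> space M" for x
    using normalised_step(1)[OF that] by (rule incseq_SucI)
  have ge1: "1 \<le> normalised n x" if "x \<in> space M" for n x
    using incseqD[OF inc[OF that], of 0 n] by (simp add: normalised_def)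
  have leG: "normalised n x \<le> G" if "x \<in> space M" for n x
    using normalised_le[OF that] by (simp add: G_def)
  have lim: "(\<lambda>n. normalised n x) \<longlonglongrightarrow> u x" if x: "x \<in> space M" for x
    unfolding u_def using incseq_convergent[OF inc[OF x], of G] leG[OF x]
    by (metis limI)
  have u_ge: "1 \<le> u x" and u_le: "u x \<le> G" if "x \<in> space M" for x
    using lim[OF that] ge1[OF that] leG[OF that]
    by (auto intro: LIMSEQ_le_const LIMSEQ_le_const2)
  have m [measurable]: "iter n \<in> borel_measurable M" for n
    by (rule bounded_fun_measurable[OF bounded_iter])
  have [measurable]: "normalised n \<in> borel_measurable M" for n
    unfolding normalised_def[abs_def] by measurable
  have mu [measurable]: "u \<in> borel_measurable M"
    by (rule borel_measurable_LIMSEQ_metric[OF _ lim]) measurable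
  have bu: "bounded_fun M u"
    using u_ge u_le by (intro bounded_funI[where C=G]) (force)+
  obtain l where l: "lower \<longlonglongrightarrow> l"
  proof (rule incseq_convergent[OF lower_mono, of "2 * A"])
    show "\<forall>i. lower i \<le> 2 * A"
      using mean_ratio_bounds decseqD[OF upper_mono, of 0] by (force intro: order_trans)
  qed
  have "1 \<le> l" using l lower_ge_1 by (auto intro: LIMSEQ_le_const)
  moreover have "apply_kernel u x = l * u x" if x: "x \<in> space M" for x
  proof (rule LIMSEQ_unique)
    show "(\<lambda>n. apply_kernel (normalised n) x) \<longlonglongrightarrow> apply_kernel u x"
      unfolding apply_kernel_def
    proof (rule integral_dominated_convergence[where w="\<lambda>y. k x y * G"])
      show "integrable M (\<lambda>y. k x y * G)" using kernel_integrable[OF x] by simp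
      show "AE y in M. (\<lambda>n. k x y * normalised n y) \<longlonglongrightarrow> k x y * u y"
        using AE_space by eventually_elim (intro tendsto_intros lim)
      show "AE y in M. norm (k x y * normalised n y) \<le> k x y * G" for n
        using kernel_ge[OF x] AE_space
      proof eventually_elim
        case (elim y)
        have "\<bar>normalised n y\<bar> \<le> G" using ge1[OF elim(2), of n] leG[OF elim(2), of n] by linarith
        then show ?case using elim(1) by (auto simp: abs_mult intro!: mult_left_mono)
      qed
    qed (use x in measurable)
    show "(\<lambda>n. apply_kernel (normalised n) x) \<longlonglongrightarrow> l * u x"
      unfolding apply_kernel_normalised[OF x] by (intro tendsto_mult l LIMSEQ_Suc lim x)
  qed
  ultimately show ?thesis using that bu u_ge by blast
qed

section \<open>Symmetry and maximality of the positive eigenvalue\<close>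

lemma kernel_integral_le:
  assumes x: "x \<in> space M"
  shows "(\<integral>y. \<bar>k x y\<bar> \<partial>M) \<le> 1 / 2 + A"
proof -
  have "(\<integral>y. \<bar>k x y\<bar> \<partial>M) \<le> (\<integral>y. q x y + A \<partial>M)"
  proof (rule integral_mono_AE)
    show "AE y in M. \<bar>k x y\<bar> \<le> q x y + A"
      using kernel_ge[OF x] AE_space by eventually_elim (use kernel_le[OF x] in fastforce)
  qed (use kernel_integrable[OF x] q_integrable[OF x] in auto)
  also have "\<dots> = (\<integral>y. q x y \<partial>M) + A" using q_integrable[OF x] mass by simp
  finally show ?thesis using q_small[OF x] by simp
qed

lemma bounded_fun_apply_kernel:
  assumes f: "bounded_fun M f"
  shows "bounded_fun M (apply_kernel f)"
proof -
  obtain C where C: "\<forall>x\<in>space M. \<bar>f x\<bar> \<le> C" using f unfolding bounded_fun_def by blast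
  show ?thesis
  proof (rule bounded_funI)
    show "apply_kernel f \<in> borel_measurable M"
      using bounded_fun_measurable[OF f] by (rule apply_kernel_measurable)
    fix x assume x: "x \<in> space M"
    have C0: "0 \<le> C" using bspec[OF C x] by linarith
    have "\<bar>apply_kernel f x\<bar> \<le> (\<integral>y. \<bar>k x y * f y\<bar> \<partial>M)"
      unfolding apply_kernel_def by (rule integral_abs_bound)
    also have "\<dots> \<le> (\<integral>y. \<bar>k x y\<bar> * C \<partial>M)"
    proof (rule integral_mono)
      show "integrable M (\<lambda>y. \<bar>k x y * f y\<bar>)" using kernel_mult_integrable[OF x f] by (rule integrable_abs)
      show "integrable M (\<lambda>y. \<bar>k x y\<bar> * C)" using kernel_integrable[OF x] by simp
      show "\<bar>k x y * f y\<bar> \<le> \<bar>k x y\<bar> * C" if "y \<in> space M" for y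
        unfolding abs_mult using C that by (intro mult_left_mono) auto
    qed
    also have "\<dots> = (\<integral>y. \<bar>k x y\<bar> \<partial>M) * C" by simp
    also have "\<dots> \<le> (1 / 2 + A) * C" using kernel_integral_le[OF x] C0 by (rule mult_right_mono)
    finally show "\<bar>apply_kernel f x\<bar> \<le> (1 / 2 + A) * C" .
  qed
qed

lemma apply_kernel_self_adjoint:
  assumes f: "bounded_fun M f" and g: "bounded_fun M g"
  shows "(\<integral>x. f x * apply_kernel g x \<partial>M) = (\<integral>x. g x * apply_kernel f x \<partial>M)"
proof -
  interpret P: pair_sigma_finite M M ..
  note [measurable] = f[THEN bounded_fun_measurable] g[THEN bounded_fun_measurable]
  obtain C D where C: "\<forall>x\<in>space M. \<bar>f x\<bar> \<le> C" and D: "\<forall>x\<in>space M. \<bar>g x\<bar> \<le> D"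
    using assms unfolding bounded_fun_def by blast
  let ?h = "\<lambda>x y. f x * (k x y * g y)"
  have int: "integrable (M \<Otimes>\<^sub>M M) (case_prod ?h)"
  proof (rule P.Fubini_integrable)
    have *: "\<bar>\<integral>y. \<bar>?h x y\<bar> \<partial>M\<bar> \<le> C * (D * (1 / 2 + A))" if x: "x \<in> space M" for x
    proof -
      have C0: "0 \<le> C" and D0: "0 \<le> D" using C D x by (fastforce intro: order_trans[OF abs_ge_zero])+
      have "(\<integral>y. \<bar>?h x y\<bar> \<partial>M) \<le> (\<integral>y. C * (D * \<bar>k x y\<bar>) \<partial>M)"
      proof (rule integral_mono)
        show "integrable M (\<lambda>y. \<bar>?h x y\<bar>)"
          using kernel_mult_integrable[OF x g] by simp
        show "integrable M (\<lambda>y. C * (D * \<bar>k x y\<bar>))" using kernel_integrable[OF x] by simp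
        show "\<bar>?h x y\<bar> \<le> C * (D * \<bar>k x y\<bar>)" if y: "y \<in> space M" for y
          unfolding abs_mult using C D x y C0 D0
          by (subst mult.commute[of "\<bar>k x y\<bar>"]) (intro mult_mono, auto)
      qed
      also have "\<dots> = C * (D * (\<integral>y. \<bar>k x y\<bar> \<partial>M))" by simp
      also have "\<dots> \<le> C * (D * (1 / 2 + A))"
        using kernel_integral_le[OF x] C0 D0 by (intro mult_left_mono) auto
      finally show ?thesis by simp
    qed
    then show "integrable M (\<lambda>x. \<integral>y. norm (case (x, y) of (x, y) \<Rightarrow> ?h x y) \<partial>M)"
      by (intro integrable_const_bound[where B="C * (D * (1 / 2 + A))"]) auto
    show "AE x in M. integrable M (\<lambda>y. case (x, y) of (x, y) \<Rightarrow> ?h x y)"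
      using kernel_mult_integrable[OF _ g] by auto
  qed measurable
  have "(\<integral>x. f x * apply_kernel g x \<partial>M) = (\<integral>x. \<integral>y. ?h x y \<partial>M \<partial>M)"
    unfolding apply_kernel_def by simp
  also have "\<dots> = (\<integral>y. \<integral>x. ?h x y \<partial>M \<partial>M)" using P.Fubini_integral[OF int] by simp
  also have "\<dots> = (\<integral>y. g y * apply_kernel f y \<partial>M)"
  proof (rule Bochner_Integration.integral_cong[OF refl])
    fix y
    have "(\<integral>x. ?h x y \<partial>M) = (\<integral>x. g y * (k y x * f x) \<partial>M)"
      by (simp add: kernel_sym[of _ y] algebra_simps)
    then show "(\<integral>x. ?h x y \<partial>M) = g y * apply_kernel f y" unfolding apply_kernel_def by simp
  qed
  finally show ?thesis .
qed

text \<open>Taking absolute values in \<open>apply_kernel f = c f\<close> gives \<open>c \<bar>f\<bar> \<le> apply_kernel \<bar>f\<bar>\<close>. Integrate this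
  against \<open>u\<close> and move the operator onto \<open>u\<close> by symmetry: \<open>c \<integral> u \<bar>f\<bar> \<le> l \<integral> u \<bar>f\<bar>\<close>, with a positive
  and finite integral. Extended nonnegative integrals are used because \<open>apply_kernel \<bar>f\<bar>\<close> may be
  infinite at some points.\<close>

lemma eigenvalue_le:
  assumes u: "bounded_fun M u" and u_ge: "\<And>x. x \<in> space M \<Longrightarrow> 1 \<le> u x"
    and eig: "\<And>x. x \<in> space M \<Longrightarrow> apply_kernel u x = l * u x" and l: "0 \<le> l"
    and f: "integrable M f" and nz: "\<not> (AE x in M. f x = 0)"
    and feig: "AE x in M. apply_kernel f x = c * f x"
  shows "c \<le> l"
proof (cases "0 \<le> c")
  case True
  interpret P: pair_sigma_finite M M ..
  note [measurable] = u[THEN bounded_fun_measurable] borel_measurable_integrable[OF f]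
  obtain C where C: "\<forall>x\<in>space M. \<bar>u x\<bar> \<le> C" using u unfolding bounded_fun_def by blast
  define j where "j = (\<integral>x. u x * \<bar>f x\<bar> \<partial>M)"
  have int: "integrable M (\<lambda>x. u x * \<bar>f x\<bar>)"
  proof (rule Bochner_Integration.integrable_bound)
    show "integrable M (\<lambda>x. C * \<bar>f x\<bar>)" using f by simp
    show "AE x in M. norm (u x * \<bar>f x\<bar>) \<le> norm (C * \<bar>f x\<bar>)"
      using AE_space by eventually_elim (use C in \<open>force simp: abs_mult intro!: mult_right_mono\<close>)
  qed measurable
  have u0: "0 \<le> u x" if "x \<in> space M" for x using u_ge[OF that] by simp
  have J: "(\<integral>\<^sup>+x. ennreal (u x) * ennreal \<bar>f x\<bar> \<partial>M) = ennreal j"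
  proof -
    have "(\<integral>\<^sup>+x. ennreal (u x) * ennreal \<bar>f x\<bar> \<partial>M) = (\<integral>\<^sup>+x. ennreal (u x * \<bar>f x\<bar>) \<partial>M)"
      using u0 by (intro nn_integral_cong) (simp add: ennreal_mult)
    also have "\<dots> = ennreal j"
      unfolding j_def using u0 by (intro nn_integral_eq_integral int) auto
    finally show ?thesis .
  qed
  have "0 < (\<integral>x. \<bar>f x\<bar> \<partial>M)"
  proof -
    have "(\<integral>x. \<bar>f x\<bar> \<partial>M) \<noteq> 0"
      using nz f by (subst integral_nonneg_eq_0_iff_AE) auto
    moreover have "0 \<le> (\<integral>x. \<bar>f x\<bar> \<partial>M)" by simp
    ultimately show ?thesis by linarith
  qed
  also have "\<dots> \<le> j"
    unfolding j_def using f int mult_right_mono[OF u_ge abs_ge_zero] by (intro integral_mono) auto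
  finally have j: "0 < j" .
  have bound: "AE x in M. ennreal c * ennreal \<bar>f x\<bar> \<le> (\<integral>\<^sup>+y. ennreal (k x y) * ennreal \<bar>f y\<bar> \<partial>M)"
    using feig AE_space
  proof eventually_elim
    case (elim x)
    have "ennreal c * ennreal \<bar>f x\<bar> = ennreal \<bar>apply_kernel f x\<bar>"
      using True elim by (simp add: abs_mult ennreal_mult)
    also have "\<dots> \<le> (\<integral>\<^sup>+y. ennreal \<bar>k x y * f y\<bar> \<partial>M)"
      unfolding apply_kernel_def using integral_norm_bound_ennreal not_integrable_integral_eq
      by (metis (no_types, lifting) abs_zero ennreal_0 nn_integral_cong real_norm_def zero_le)
    also have "\<dots> = (\<integral>\<^sup>+y. ennreal (k x y) * ennreal \<bar>f y\<bar> \<partial>M)"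
    proof (rule nn_integral_cong_AE)
      show "AE y in M. ennreal \<bar>k x y * f y\<bar> = ennreal (k x y) * ennreal \<bar>f y\<bar>"
        using kernel_ge[OF elim(2)] by eventually_elim (simp add: abs_mult ennreal_mult)
    qed
    finally show ?case .
  qed
  have Ku: "(\<integral>\<^sup>+x. ennreal (u x) * ennreal (k x y) \<partial>M) = ennreal (l * u y)" if y: "y \<in> space M" for y
  proof -
    have "(\<integral>\<^sup>+x. ennreal (u x) * ennreal (k x y) \<partial>M) = (\<integral>\<^sup>+x. ennreal (k y x * u x) \<partial>M)"
    proof (rule nn_integral_cong_AE)
      show "AE x in M. ennreal (u x) * ennreal (k x y) = ennreal (k y x * u x)"
        using kernel_ge[OF y] AE_space
        by eventually_elim (use u0 in \<open>simp add: kernel_sym[of _ y] ennreal_mult mult.commute\<close>)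
    qed
    also have "\<dots> = ennreal (apply_kernel u y)"
      unfolding apply_kernel_def
    proof (rule nn_integral_eq_integral[OF kernel_mult_integrable[OF y u]])
      show "AE x in M. 0 \<le> k y x * u x"
        using kernel_ge[OF y] AE_space by eventually_elim (use u0 in auto)
    qed
    finally show ?thesis using eig[OF y] by simp
  qed
  have "ennreal c * ennreal j = (\<integral>\<^sup>+x. ennreal c * (ennreal (u x) * ennreal \<bar>f x\<bar>) \<partial>M)"
    by (simp add: nn_integral_cmult J)
  also have "\<dots> = (\<integral>\<^sup>+x. ennreal (u x) * (ennreal c * ennreal \<bar>f x\<bar>) \<partial>M)"
    by (simp add: ac_simps)
  also have "\<dots> \<le> (\<integral>\<^sup>+x. ennreal (u x) * (\<integral>\<^sup>+y. ennreal (k x y) * ennreal \<bar>f y\<bar> \<partial>M) \<partial>M)"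
  proof (rule nn_integral_mono_AE)
    show "AE x in M. ennreal (u x) * (ennreal c * ennreal \<bar>f x\<bar>)
        \<le> ennreal (u x) * (\<integral>\<^sup>+y. ennreal (k x y) * ennreal \<bar>f y\<bar> \<partial>M)"
      using bound by eventually_elim (rule mult_left_mono, auto)
  qed
  also have "\<dots> = (\<integral>\<^sup>+x. \<integral>\<^sup>+y. ennreal (u x) * (ennreal (k x y) * ennreal \<bar>f y\<bar>) \<partial>M \<partial>M)"
    by (intro nn_integral_cong nn_integral_cmult[symmetric]) measurable
  also have "\<dots> = (\<integral>\<^sup>+y. \<integral>\<^sup>+x. ennreal (u x) * (ennreal (k x y) * ennreal \<bar>f y\<bar>) \<partial>M \<partial>M)"
    by (rule P.Fubini'[symmetric]) measurable
  also have "\<dots> = (\<integral>\<^sup>+y. (\<integral>\<^sup>+x. ennreal (u x) * ennreal (k x y) \<partial>M) * ennreal \<bar>f y\<bar> \<partial>M)"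
    by (simp add: mult.assoc[symmetric] nn_integral_multc cong: nn_integral_cong)
  also have "\<dots> = (\<integral>\<^sup>+y. ennreal l * (ennreal (u y) * ennreal \<bar>f y\<bar>) \<partial>M)"
    using l u0 by (intro nn_integral_cong) (simp add: Ku ennreal_mult mult.assoc)
  also have "\<dots> = ennreal l * ennreal j" by (simp add: nn_integral_cmult J)
  finally have "ennreal (c * j) \<le> ennreal (l * j)" using True l j by (simp add: ennreal_mult)
  then show ?thesis using l j by (simp add: ennreal_le_iff)
qed (use l in simp)

end

section \<open>The Riesz kernel on the unit interval\<close>

definition riesz :: "real \<Rightarrow> real \<Rightarrow> real \<Rightarrow> real" where
  "riesz a x y = \<bar>x - y\<bar> powr (- a)"

lemma has_integral_riesz:
  fixes a x :: real
  assumes a: "0 < a" "a < 1" and x: "0 < x" "x < 1"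
  shows "((\<lambda>y. \<bar>x - y\<bar> powr (- a)) has_integral
           ((x powr (1 - a) + (1 - x) powr (1 - a)) / (1 - a))) {0<..<1}"
proof -
  let ?f = "\<lambda>y. \<bar>x - y\<bar> powr (- a)"
  have cont: "continuous_on S (\<lambda>y. \<bar>x - y\<bar> powr (1 - a))" for S
    using a by (intro continuous_on_powr' continuous_intros) auto
  \<comment> \<open>The antiderivative changes its formula at the singularity,
    so the two sides are integrated separately.\<close>
  have left: "(?f has_integral
      (- (\<bar>x - x\<bar> powr (1 - a)) / (1 - a) - - (\<bar>x - 0\<bar> powr (1 - a)) / (1 - a))) {0..x}"
  proof (rule fundamental_theorem_of_calculus_interior)
    show "continuous_on {0..x} (\<lambda>y. - (\<bar>x - y\<bar> powr (1 - a)) / (1 - a))"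
      using a by (intro continuous_intros cont) auto
    fix y assume y: "y \<in> {0<..<x}"
    have "((\<lambda>y. - ((x - y) powr (1 - a)) / (1 - a)) has_real_derivative \<bar>x - y\<bar> powr (- a)) (at y)"
      using y a by (auto intro!: derivative_eq_intros simp: divide_simps)
    then have "((\<lambda>y. - (\<bar>x - y\<bar> powr (1 - a)) / (1 - a)) has_real_derivative \<bar>x - y\<bar> powr (- a)) (at y)"
      by (rule DERIV_cong_ev[THEN iffD1, rotated -1, of _ _ y])
        (use y in \<open>auto intro!: eventually_mono[OF eventually_nhds_in_open[of "{0<..<x}"]]\<close>)
    then show "((\<lambda>y. - (\<bar>x - y\<bar> powr (1 - a)) / (1 - a)) has_vector_derivative \<bar>x - y\<bar> powr (- a)) (at y)"
      by (simp add: has_real_derivative_iff_has_vector_derivative)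
  qed (use x in simp)
  have right: "(?f has_integral
      ((\<bar>x - 1\<bar> powr (1 - a)) / (1 - a) - (\<bar>x - x\<bar> powr (1 - a)) / (1 - a))) {x..1}"
  proof (rule fundamental_theorem_of_calculus_interior)
    show "continuous_on {x..1} (\<lambda>y. (\<bar>x - y\<bar> powr (1 - a)) / (1 - a))"
      using a by (intro continuous_intros cont) auto
    fix y assume y: "y \<in> {x<..<1}"
    have "((\<lambda>y. ((y - x) powr (1 - a)) / (1 - a)) has_real_derivative \<bar>x - y\<bar> powr (- a)) (at y)"
      using y a by (auto intro!: derivative_eq_intros simp: divide_simps)
    then have "((\<lambda>y. (\<bar>x - y\<bar> powr (1 - a)) / (1 - a)) has_real_derivative \<bar>x - y\<bar> powr (- a)) (at y)"
      by (rule DERIV_cong_ev[THEN iffD1, rotated -1, of _ _ y])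
        (use y in \<open>auto intro!: eventually_mono[OF eventually_nhds_in_open[of "{x<..<1}"]]\<close>)
    then show "((\<lambda>y. (\<bar>x - y\<bar> powr (1 - a)) / (1 - a)) has_vector_derivative \<bar>x - y\<bar> powr (- a)) (at y)"
      by (simp add: has_real_derivative_iff_has_vector_derivative)
  qed (use x in simp)
  show ?thesis
    using has_integral_combine[OF _ _ left right] x a
    by (simp add: has_integral_Icc_iff_Ioo add_divide_distrib)
qed

lemma integrable_unit_of_has_integral:
  fixes f :: "real \<Rightarrow> real"
  assumes "(f has_integral I) {0<..<1}" "\<And>x. 0 \<le> f x"
  shows "integrable unit_measure f" "integral\<^sup>L unit_measure f = I"
proof -
  have "f absolutely_integrable_on {0<..<1}"
    using assms by (intro nonnegative_absolutely_integrable_1) (auto simp: integrable_on_def)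
  then show i: "integrable unit_measure f"
    by (intro absolutely_integrable_imp_integrable) auto
  show "integral\<^sup>L unit_measure f = I"
    using lebesgue_integral_eq_integral[OF i] assms(1) by (simp add: integral_unique)
qed

lemma riesz_integral:
  assumes "0 < a" "a < 1" "x \<in> {0<..<1}"
  shows "integrable unit_measure (riesz a x)"
    and "integral\<^sup>L unit_measure (riesz a x) = (x powr (1 - a) + (1 - x) powr (1 - a)) / (1 - a)"
  using integrable_unit_of_has_integral[OF has_integral_riesz[of a x]] assms
  by (auto simp: riesz_def[abs_def])

lemma riesz_sym: "riesz a x y = riesz a y x"
  by (simp add: riesz_def abs_minus_commute)

lemma trace_K_sq_eq:
  assumes a: "0 < \<alpha>" "\<alpha> < 1 / 2"
  shows "trace_K_sq \<alpha> = 1 / ((1 - 2 * \<alpha>) * (1 - \<alpha>))"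
proof -
  define b where "b = 1 - 2 * \<alpha>"
  have b: "0 < b" using a by (simp add: b_def)
  have inner: "(\<integral>x. \<bar>x - y\<bar> powr (- 2 * \<alpha>) \<partial>unit_measure) = (y powr b + (1 - y) powr b) / b"
    if "y \<in> {0<..<1}" for y
    using riesz_integral(2)[of "2 * \<alpha>" y] a that
    by (simp add: riesz_def[abs_def] b_def abs_minus_commute)
  have "((\<lambda>y. (y powr b + (1 - y) powr b) / b) has_integral
      ((1 powr (b + 1) - (1 - 1) powr (b + 1)) / ((b + 1) * b)
        - (0 powr (b + 1) - (1 - 0) powr (b + 1)) / ((b + 1) * b))) {0..1::real}"
  proof (rule fundamental_theorem_of_calculus_interior)
    show "continuous_on {0..1} (\<lambda>y. (y powr (b + 1) - (1 - y) powr (b + 1)) / ((b + 1) * b))"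
      using b by (intro continuous_intros continuous_on_powr') auto
    fix y :: real assume y: "y \<in> {0<..<1}"
    have "((\<lambda>y. (y powr (b + 1) - (1 - y) powr (b + 1)) / ((b + 1) * b)) has_real_derivative
        (y powr b + (1 - y) powr b) / b) (at y)"
      using y b by (auto intro!: derivative_eq_intros simp: divide_simps) (simp add: algebra_simps)
    then show "((\<lambda>y. (y powr (b + 1) - (1 - y) powr (b + 1)) / ((b + 1) * b)) has_vector_derivative
        (y powr b + (1 - y) powr b) / b) (at y)"
      by (simp add: has_real_derivative_iff_has_vector_derivative)
  qed simp
  then have "((\<lambda>y. (y powr b + (1 - y) powr b) / b) has_integral 2 / ((b + 1) * b)) {0<..<1::real}"
    by (simp add: has_integral_Icc_iff_Ioo mult.commute)
  then have "(\<integral>y. (y powr b + (1 - y) powr b) / b \<partial>unit_measure) = 2 / ((b + 1) * b)"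
    using b by (intro integrable_unit_of_has_integral) auto
  moreover have "trace_K_sq \<alpha> = (\<integral>y. (y powr b + (1 - y) powr b) / b \<partial>unit_measure)"
    unfolding trace_K_sq_def using inner by (intro Bochner_Integration.integral_cong) auto
  moreover have "2 / ((b + 1) * b) = 1 / ((1 - 2 * \<alpha>) * (1 - \<alpha>))"
    using a by (simp add: b_def divide_simps)
  ultimately show ?thesis by simp
qed

text \<open>The exponent \<open>a = 1/2\<close> is the worst. There, with \<open>s = t powr (-1/4)\<close>, the claim is \<open>s\<^sup>2 \<le> s\<^sup>3 / 16 + 16\<^sup>2\<close>, clear for \<open>s \<ge> 16\<close> and for \<open>s \<le> 16\<close>
  separately. The factor \<open>1/16\<close> is chosen because the row integrals of \<open>riesz (3/4)\<close> are at most
  \<open>8\<close>, which leaves \<open>1/2\<close>.\<close>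

lemma powr_neg_le_three_quarters:
  assumes t: "0 \<le> (t::real)" "t \<le> 1" and a: "0 < a" "a \<le> 1 / 2"
  shows "t powr (- a) \<le> t powr (- (3 / 4)) / 16 + 256"
proof (cases "t = 0")
  case False
  then have t0: "0 < t" using t by simp
  define s where "s = t powr (- (1 / 4))"
  have s: "0 \<le> s" by (simp add: s_def)
  have s2: "s ^ 2 = t powr (- (1 / 2))" and s3: "s ^ 3 = t powr (- (3 / 4))"
    using t0 by (simp_all add: s_def powr_power)
  have "t powr (- a) \<le> s ^ 2" unfolding s2 using t t0 a by (intro powr_mono') auto
  also have "\<dots> \<le> s ^ 3 / 16 + 256"
  proof (cases "16 \<le> s")
    case True
    then have "0 \<le> s ^ 2 * (s - 16)" by simp
    then show ?thesis by (simp add: power2_eq_square power3_eq_cube algebra_simps)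
  next
    case False
    then have "s ^ 2 \<le> 16 ^ 2" using s by (intro power_mono) auto
    then show ?thesis using s by (simp add: add_increasing)
  qed
  finally show ?thesis unfolding s3 .
qed simp

text \<open>With \<open>e = 1/2 - a\<close> the difference is \<open>t powr (-1/2) * (1 - t powr e)\<close>, where
  \<open>1 - t powr e \<le> - e ln t \<le> 4 e t powr (-1/4)\<close>.\<close>

lemma powr_diff_bounds:
  assumes t: "0 \<le> (t::real)" "t \<le> 1" and a: "0 < a" "a \<le> 1 / 2"
  shows "0 \<le> t powr (- (1 / 2)) - t powr (- a)"
    and "t powr (- (1 / 2)) - t powr (- a) \<le> 2 * (1 - 2 * a) * t powr (- (3 / 4))"
proof -
  show "0 \<le> t powr (- (1 / 2)) - t powr (- a)"
    using t a by (cases "t = 0") (auto intro!: powr_mono')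
  show "t powr (- (1 / 2)) - t powr (- a) \<le> 2 * (1 - 2 * a) * t powr (- (3 / 4))"
  proof (cases "t = 0")
    case False
    then have t0: "0 < t" using t by simp
    define e where "e = 1 / 2 - a"
    have e: "0 \<le> e" using a by (simp add: e_def)
    have "1 + e * ln t \<le> t powr e"
      using exp_ge_add_one_self[of "e * ln t"] t0 by (simp add: powr_def)
    moreover have "- ln t \<le> 4 * t powr (- (1 / 4))"
      using ln_add_one_self_le_self2[of "t powr (- (1 / 4)) - 1"] t0 by (simp add: ln_powr)
    then have "e * (- ln t) \<le> e * (4 * t powr (- (1 / 4)))" using e by (rule mult_left_mono)
    ultimately have "1 - t powr e \<le> 4 * e * t powr (- (1 / 4))" by simp
    then have "t powr (- (1 / 2)) * (1 - t powr e) \<le> t powr (- (1 / 2)) * (4 * e * t powr (- (1 / 4)))"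
      by (rule mult_left_mono) simp
    also have "\<dots> = 4 * e * t powr (- (3 / 4))"
      by (simp add: powr_add[symmetric])
    finally show ?thesis
      using t0 by (simp add: right_diff_distrib powr_add[symmetric] e_def)
  qed simp
qed

lemma unit_measure_props:
  "finite_measure unit_measure" "measure unit_measure (space unit_measure) = 1"
proof -
  show "finite_measure unit_measure"
    by (rule finite_measure_lebesgue_on) auto
  show "measure unit_measure (space unit_measure) = 1"
    by (simp add: measure_restrict_space)
qed

lemma riesz_measurable:
  "case_prod (riesz a) \<in> borel_measurable (unit_measure \<Otimes>\<^sub>M unit_measure)"
proof -
  have id: "(\<lambda>x. x) \<in> borel_measurable unit_measure"
    by (intro measurable_restrict_space1 measurable_completion) simp
  have "fst \<in> borel_measurable (unit_measure \<Otimes>\<^sub>M unit_measure)"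
    "snd \<in> borel_measurable (unit_measure \<Otimes>\<^sub>M unit_measure)"
    by (rule measurable_compose[OF measurable_fst id], rule measurable_compose[OF measurable_snd id])
  then show ?thesis unfolding riesz_def case_prod_beta' by measurable
qed

lemma AE_unit_neq: "AE y in unit_measure. x \<noteq> y"
proof -
  have "AE y in lborel. y \<noteq> x" by (rule AE_lborel_singleton)
  then have "AE y in lebesgue. y \<noteq> x" by (rule AE_completion)
  then have "AE y in unit_measure. y \<noteq> x" by (subst AE_restrict_space_iff) auto
  then show ?thesis by (auto simp: eq_commute)
qed

lemma riesz_three_quarters_integral_le:
  assumes x: "x \<in> {0<..<1}"
  shows "integral\<^sup>L unit_measure (riesz (3 / 4) x) \<le> 8"
proof -
  have "x powr (1 / 4) \<le> 1" "(1 - x) powr (1 / 4) \<le> 1"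
    using x by (auto intro: powr_le1)
  then show ?thesis using riesz_integral(2)[of "3 / 4" x] x by simp
qed

text \<open>The auxiliary kernel and the constant are the same for all exponents up to \<open>1/2\<close>, including
  the critical exponent, whose kernel is not square integrable.\<close>

lemma riesz_kernel:
  assumes a: "0 < \<alpha>" "\<alpha> \<le> 1 / 2"
  shows "bounded_below_kernel unit_measure (riesz \<alpha>) (\<lambda>x y. riesz (3 / 4) x y / 16) 256"
proof (intro bounded_below_kernel.intro bounded_below_kernel_axioms.intro)
  fix x :: real assume x: "x \<in> space unit_measure"
  show "AE y in unit_measure. 1 \<le> riesz \<alpha> x y"
    using AE_unit_neq[of x] AE_space
  proof eventually_elim
    case (elim y)
    then have "0 < \<bar>x - y\<bar>" "\<bar>x - y\<bar> \<le> 1" using x by auto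
    then show ?case unfolding riesz_def using powr_mono'[of "- \<alpha>" 0 "\<bar>x - y\<bar>"] a by simp
  qed
  show "integrable unit_measure (\<lambda>y. riesz (3 / 4) x y / 16)"
    using riesz_integral(1)[of "3 / 4" x] x by simp
  show "(\<integral>y. riesz (3 / 4) x y / 16 \<partial>unit_measure) \<le> 1 / 2"
    using riesz_three_quarters_integral_le[of x] x by simp
  fix y assume y: "y \<in> space unit_measure"
  show "riesz \<alpha> x y \<le> riesz (3 / 4) x y / 16 + 256"
    unfolding riesz_def using x y a by (intro powr_neg_le_three_quarters) auto
qed (use unit_measure_props riesz_measurable riesz_sym in \<open>auto simp: riesz_def\<close>)

text \<open>The positive eigenfunction is square integrable, and every square-integrable eigenfunction
  is integrable, so \<open>eigenvalue_le\<close> identifies the positive eigenvalue as the greatest one. In particular,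
  the maximum in the definition of \<open>lambda_max\<close> is attained.\<close>

lemma positive_eigenfunction_K:
  assumes a: "0 < \<alpha>" "\<alpha> \<le> 1 / 2"
  obtains u where "bounded_fun unit_measure u"
    "\<And>x. x \<in> {0<..<1} \<Longrightarrow> 1 \<le> u x"
    "\<And>x. x \<in> {0<..<1} \<Longrightarrow> K_op \<alpha> u x = lambda_max (K_op \<alpha>) * u x"
    "1 \<le> lambda_max (K_op \<alpha>)"
proof -
  interpret bounded_below_kernel unit_measure "riesz \<alpha>" "\<lambda>x y. riesz (3 / 4) x y / 16" 256
    by (rule riesz_kernel[OF a])
  have K: "K_op \<alpha> = apply_kernel"
    by (intro ext) (simp add: K_op_def apply_kernel_def riesz_def)
  obtain u l where u: "bounded_fun unit_measure u" and ge: "\<And>x. x \<in> space unit_measure \<Longrightarrow> 1 \<le> u x"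
    and eig: "\<And>x. x \<in> space unit_measure \<Longrightarrow> apply_kernel u x = l * u x" and l: "1 \<le> l"
    using positive_eigenfunction by metis
  have "lambda_max (K_op \<alpha>) = l"
    unfolding lambda_max_def
  proof (rule Greatest_equality)
    have "u \<in> L2_unit"
      using bounded_fun_measurable[OF u] integrable_bounded_fun[OF bounded_fun_mult[OF u u]]
      by (simp add: L2_unit_def power2_eq_square)
    moreover have "\<not> (AE x in unit_measure. u x = 0)"
    proof
      assume "AE x in unit_measure. u x = 0"
      then have "AE x in unit_measure. False"
        using AE_space by eventually_elim (use ge in force)
      then show False using mass
        by (simp add: eventually_False ae_filter_eq_bot_iff measure_def)
    qed
    ultimately show "L2_eigenvalue (K_op \<alpha>) l"
      unfolding L2_eigenvalue_def K using eig by (intro bexI[of _ u]) auto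
    fix c assume "L2_eigenvalue (K_op \<alpha>) c"
    then obtain f where f: "f \<in> L2_unit" "\<not> (AE x in unit_measure. f x = 0)"
      "AE x in unit_measure. apply_kernel f x = c * f x"
      unfolding L2_eigenvalue_def K by blast
    have "integrable unit_measure f"
    proof (rule Bochner_Integration.integrable_bound)
      show "integrable unit_measure (\<lambda>x. 1 + (f x)\<^sup>2)" using f(1) unfolding L2_unit_def by simp
      show "AE x in unit_measure. norm (f x) \<le> norm (1 + (f x)\<^sup>2)"
      proof (intro AE_I2)
        fix x
        have "0 \<le> (\<bar>f x\<bar> - 1)\<^sup>2" by simp
        then show "norm (f x) \<le> norm (1 + (f x)\<^sup>2)"
          unfolding power2_diff by simp
      qed
    qed (use f(1) in \<open>simp add: L2_unit_def\<close>)
    then show "c \<le> l" using eigenvalue_le[OF u ge eig _ _ f(2,3)] l by simp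
  qed
  then show ?thesis using that u ge eig l K by auto
qed

section \<open>The leading eigenvalue near the critical exponent\<close>

text \<open>Pairing the two positive eigenfunctions avoids operator norms and Rayleigh quotients:
  \<open>(lambda_star - l) \<integral> u v = \<integral> u (K_op (1/2) v - K_op \<alpha> v)\<close>. The right-hand side is between \<open>0\<close>
  and \<open>E \<integral> u \<le> E \<integral> u v\<close>, since \<open>v \<ge> 1\<close>. The bound \<open>E\<close> is the supremum \<open>D\<close> of \<open>v\<close> times \<open>2 (1 - 2\<alpha>)\<close>
  times the bound \<open>8\<close> for the row integrals of \<open>riesz (3/4)\<close>.\<close>

lemma lambda_max_lipschitz:
  "\<exists>C. \<forall>\<alpha>\<in>{0<..<1/2}. \<bar>lambda_max (K_op \<alpha>) - lambda_star\<bar> \<le> C * (1 - 2 * \<alpha>)"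
proof -
  interpret S: bounded_below_kernel unit_measure "riesz (1 / 2)" "\<lambda>x y. riesz (3 / 4) x y / 16" 256
    by (rule riesz_kernel) auto
  obtain v where v: "bounded_fun unit_measure v" and v_ge: "\<And>x. x \<in> {0<..<1} \<Longrightarrow> 1 \<le> v x"
    and v_eig: "\<And>x. x \<in> {0<..<1} \<Longrightarrow> K_op (1 / 2) v x = lambda_star * v x"
    unfolding lambda_star_def by (rule positive_eigenfunction_K[of "1 / 2"]) auto
  obtain D where D: "\<forall>x\<in>space unit_measure. \<bar>v x\<bar> \<le> D"
    using v unfolding bounded_fun_def by blast
  have "\<bar>lambda_max (K_op \<alpha>) - lambda_star\<bar> \<le> 16 * D * (1 - 2 * \<alpha>)"
    if a: "0 < \<alpha>" "\<alpha> < 1 / 2" for \<alpha>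
  proof -
    interpret bounded_below_kernel unit_measure "riesz \<alpha>" "\<lambda>x y. riesz (3 / 4) x y / 16" 256
      using a by (intro riesz_kernel) auto
    have K: "K_op \<alpha> = apply_kernel"
      by (intro ext) (simp add: K_op_def apply_kernel_def riesz_def)
    define l where "l = lambda_max (K_op \<alpha>)"
    obtain u where u: "bounded_fun unit_measure u" and u_ge: "\<And>x. x \<in> {0<..<1} \<Longrightarrow> 1 \<le> u x"
      and u_eig: "\<And>x. x \<in> {0<..<1} \<Longrightarrow> apply_kernel u x = l * u x"
      unfolding l_def K[symmetric] by (rule positive_eigenfunction_K[of \<alpha>]) (use a in auto)
    define p where "p = (\<integral>x. u x * v x \<partial>unit_measure)"
    define E where "E = 16 * D * (1 - 2 * \<alpha>)"
    have gap: "0 \<le> lambda_star * v x - apply_kernel v x"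
      "lambda_star * v x - apply_kernel v x \<le> E" if x: "x \<in> {0<..<1}" for x
    proof -
      have xs: "x \<in> space unit_measure" using x by simp
      let ?d = "\<lambda>y. riesz (1 / 2) x y * v y - riesz \<alpha> x y * v y"
      note i = S.kernel_mult_integrable[OF xs v] kernel_mult_integrable[OF xs v]
      have eq: "lambda_star * v x - apply_kernel v x = (\<integral>y. ?d y \<partial>unit_measure)"
        using i v_eig[OF x] unfolding apply_kernel_def by (simp add: K_op_def riesz_def)
      have d: "0 \<le> ?d y" "?d y \<le> 2 * (1 - 2 * \<alpha>) * D * riesz (3 / 4) x y"
        if y: "y \<in> space unit_measure" for y
      proof -
        have t: "0 \<le> \<bar>x - y\<bar>" "\<bar>x - y\<bar> \<le> 1" using x y by auto
        have v0: "0 \<le> v y" "v y \<le> D" using v_ge[of y] bspec[OF D y] y by auto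
        have b: "0 \<le> riesz (1 / 2) x y - riesz \<alpha> x y"
          "riesz (1 / 2) x y - riesz \<alpha> x y \<le> 2 * (1 - 2 * \<alpha>) * riesz (3 / 4) x y"
          unfolding riesz_def using powr_diff_bounds[OF t, of \<alpha>] a by auto
        show "0 \<le> ?d y" using mult_nonneg_nonneg[OF b(1) v0(1)] by (simp add: algebra_simps)
        have "(riesz (1 / 2) x y - riesz \<alpha> x y) * v y \<le> 2 * (1 - 2 * \<alpha>) * riesz (3 / 4) x y * D"
          using b v0 by (intro mult_mono) auto
        then show "?d y \<le> 2 * (1 - 2 * \<alpha>) * D * riesz (3 / 4) x y" by (simp add: algebra_simps)
      qed
      show "0 \<le> lambda_star * v x - apply_kernel v x"
        unfolding eq using d(1) by (intro integral_nonneg_AE) auto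
      have D0: "0 \<le> D" using D xs by (fastforce intro: order_trans[OF abs_ge_zero])
      have "(\<integral>y. ?d y \<partial>unit_measure)
          \<le> (\<integral>y. 2 * (1 - 2 * \<alpha>) * D * riesz (3 / 4) x y \<partial>unit_measure)"
        using i d(2) riesz_integral(1)[of "3 / 4" x] x by (intro integral_mono) auto
      also have "\<dots> = 2 * (1 - 2 * \<alpha>) * D * (\<integral>y. riesz (3 / 4) x y \<partial>unit_measure)" by simp
      also have "\<dots> \<le> 2 * (1 - 2 * \<alpha>) * D * 8"
        using riesz_three_quarters_integral_le[OF x] a D0 by (intro mult_left_mono) auto
      finally show "lambda_star * v x - apply_kernel v x \<le> E" unfolding eq E_def by (simp add: algebra_simps)
    qed
    have uv: "bounded_fun unit_measure (\<lambda>x. u x * v x)" using u v by (rule bounded_fun_mult)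
    note int_uv = S.integrable_bounded_fun[OF uv]
    have u_le_uv: "0 < x \<Longrightarrow> x < 1 \<Longrightarrow> u x \<le> u x * v x" for x
      using u_ge[of x] v_ge[of x] by (simp add: mult_le_cancel_left1)
    have int_uAv: "integrable unit_measure (\<lambda>x. u x * apply_kernel v x)"
      using u v by (intro S.integrable_bounded_fun bounded_fun_mult bounded_fun_apply_kernel)
    have "(\<integral>x. u x * apply_kernel v x \<partial>unit_measure) = (\<integral>x. v x * apply_kernel u x \<partial>unit_measure)"
      using u v by (rule apply_kernel_self_adjoint)
    also have "\<dots> = (\<integral>x. l * (u x * v x) \<partial>unit_measure)"
      using u_eig by (intro Bochner_Integration.integral_cong) auto
    also have "\<dots> = l * p" by (simp add: p_def)
    finally have pair: "(\<integral>x. u x * apply_kernel v x \<partial>unit_measure) = l * p" .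
    have eq: "(\<integral>x. u x * (lambda_star * v x - apply_kernel v x) \<partial>unit_measure) = (lambda_star - l) * p"
    proof -
      have "(\<integral>x. u x * (lambda_star * v x - apply_kernel v x) \<partial>unit_measure)
          = (\<integral>x. lambda_star * (u x * v x) - u x * apply_kernel v x \<partial>unit_measure)"
        by (simp add: algebra_simps)
      also have "\<dots> = lambda_star * p - l * p" using int_uv int_uAv pair by (simp add: p_def)
      finally show ?thesis by (simp add: algebra_simps)
    qed
    have int_gap: "integrable unit_measure (\<lambda>x. u x * (lambda_star * v x - apply_kernel v x))"
    proof -
      have "integrable unit_measure (\<lambda>x. lambda_star * (u x * v x) - u x * apply_kernel v x)"
        using int_uv int_uAv by simp
      then show ?thesis by (simp add: algebra_simps)
    qed
    have "1 = (\<integral>x. (1::real) \<partial>unit_measure)" using mass by simp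
    also have "\<dots> \<le> p"
      unfolding p_def using int_uv u_ge u_le_uv by (intro integral_mono) (auto intro: order_trans)
    finally have p: "1 \<le> p" .
    have "0 \<le> (lambda_star - l) * p"
      unfolding eq[symmetric] using gap(1) u_ge
      by (intro integral_nonneg_AE AE_I2 mult_nonneg_nonneg) (auto intro: order_trans[OF zero_le_one])
    moreover have "(lambda_star - l) * p \<le> E * p"
    proof -
      have E: "0 \<le> E" using gap[of "1 / 2"] by simp
      have "(lambda_star - l) * p \<le> (\<integral>x. E * (u x * v x) \<partial>unit_measure)"
        unfolding eq[symmetric]
      proof (rule integral_mono[OF int_gap])
        fix x assume "x \<in> space unit_measure"
        then have x: "0 < x" "x < 1" by auto
        have "u x * (lambda_star * v x - apply_kernel v x) \<le> u x * E"
          using gap(2)[of x] u_ge[of x] x by (intro mult_left_mono) auto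
        also have "\<dots> \<le> E * (u x * v x)"
          using mult_left_mono[OF u_le_uv[OF x] E] by (simp add: mult.commute)
        finally show "u x * (lambda_star * v x - apply_kernel v x) \<le> E * (u x * v x)" .
      qed (use int_uv in simp)
      then show ?thesis by (simp add: p_def)
    qed
    ultimately have "0 \<le> lambda_star - l" "lambda_star - l \<le> E"
      using p by (auto simp: zero_le_mult_iff)
    then show ?thesis unfolding E_def l_def by simp
  qed
  then show ?thesis by (intro exI[of _ "16 * D"]) auto
qed

section \<open>The asymptotic formula\<close>

theorem proposition5p1:
  shows "\<exists>r :: real \<Rightarrow> real.
    (\<forall>\<alpha>\<in>{0<..<1/2}. Lambda2_unweighted \<alpha> = C20 * sqrt (1 - 2 * \<alpha>) * (1 + r \<alpha>)) \<and>
    r \<in> O[at_left (1/2)](\<lambda>\<alpha>. 1 - 2 * \<alpha>)"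
proof -
  define r where "r \<alpha> = lambda_max (K_op \<alpha>) / lambda_star * sqrt (2 * (1 - \<alpha>)) - 1" for \<alpha>
  have ls: "1 \<le> lambda_star"
    unfolding lambda_star_def using positive_eigenfunction_K[of "1 / 2"] by auto
  have eq: "Lambda2_unweighted \<alpha> = C20 * sqrt (1 - 2 * \<alpha>) * (1 + r \<alpha>)"
    if "\<alpha> \<in> {0<..<1/2}" for \<alpha>
  proof -
    have a: "0 < \<alpha>" "\<alpha> < 1 / 2" using that by auto
    let ?s = "1 - 2 * \<alpha>" and ?l = "lambda_max (K_op \<alpha>)"
    have "sqrt (2 * trace_K_sq \<alpha>) = 2 / (sqrt ?s * sqrt (2 * (1 - \<alpha>)))"
    proof -
      have "2 * trace_K_sq \<alpha> = 2\<^sup>2 / (?s * (2 * (1 - \<alpha>)))"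
        unfolding trace_K_sq_eq[OF a] using a by (simp add: divide_simps)
      then show ?thesis by (simp only: real_sqrt_divide real_sqrt_mult real_sqrt_abs)
    qed
    then have "Lambda2_unweighted \<alpha> = ?l * (sqrt ?s * sqrt (2 * (1 - \<alpha>))) / 2"
      unfolding Lambda2_unweighted_def by simp
    also have "\<dots> = C20 * sqrt ?s * (1 + r \<alpha>)"
      unfolding C20_def r_def using ls by simp
    finally show ?thesis .
  qed
  obtain C where C: "\<forall>\<alpha>\<in>{0<..<1/2}. \<bar>lambda_max (K_op \<alpha>) - lambda_star\<bar> \<le> C * (1 - 2 * \<alpha>)"
    using lambda_max_lipschitz by blast
  have bound: "\<bar>r \<alpha>\<bar> \<le> (2 * C + 1) * \<bar>1 - 2 * \<alpha>\<bar>" if a: "0 < \<alpha>" "\<alpha> < 1 / 2" for \<alpha>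
  proof -
    let ?l = "lambda_max (K_op \<alpha>)"
    \<comment> \<open>The eigenvalue quotient and the factor \<open>w\<close> from the trace contribute separate errors of order \<open>1 - 2\<alpha>\<close>.\<close>
    define w where "w = sqrt (2 * (1 - \<alpha>))"
    have w1: "1 \<le> w" unfolding w_def using a by simp
    have "w \<le> sqrt (2\<^sup>2)" unfolding w_def using a by (intro real_sqrt_le_mono) auto
    then have w2: "w \<le> 2" by simp
    have "(w - 1) * (w + 1) = 1 - 2 * \<alpha>" using a by (simp add: w_def algebra_simps)
    moreover have "(w - 1) * 1 \<le> (w - 1) * (w + 1)" using w1 by (intro mult_left_mono) auto
    ultimately have w3: "w - 1 \<le> 1 - 2 * \<alpha>" by simp
    have "\<bar>?l - lambda_star\<bar> / lambda_star * w \<le> \<bar>?l - lambda_star\<bar> * 2"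
    proof (rule mult_mono)
      show "\<bar>?l - lambda_star\<bar> / lambda_star \<le> \<bar>?l - lambda_star\<bar>"
        using ls by (simp add: divide_le_eq mult_le_cancel_left1)
    qed (use w1 w2 in auto)
    also have "\<dots> \<le> C * (1 - 2 * \<alpha>) * 2" using C a by (intro mult_right_mono) auto
    finally have 1: "\<bar>(?l - lambda_star) / lambda_star * w\<bar> \<le> 2 * C * (1 - 2 * \<alpha>)"
      using ls w1 by (simp add: abs_mult)
    have "r \<alpha> = (?l - lambda_star) / lambda_star * w + (w - 1)"
      unfolding r_def w_def[symmetric] using ls by (simp add: field_simps)
    then have "\<bar>r \<alpha>\<bar> \<le> \<bar>(?l - lambda_star) / lambda_star * w\<bar> + \<bar>w - 1\<bar>"
      by (simp only: abs_triangle_ineq)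
    also have "\<dots> \<le> 2 * C * (1 - 2 * \<alpha>) + (1 - 2 * \<alpha>)" using 1 w1 w3 by simp
    finally show ?thesis using a by (simp add: algebra_simps)
  qed
  have "eventually (\<lambda>\<alpha>::real. 0 < \<alpha> \<and> \<alpha> < 1 / 2) (at_left (1 / 2))"
    using eventually_at_left_real[of 0 "1 / 2"] by (auto elim: eventually_mono)
  then have "r \<in> O[at_left (1/2)](\<lambda>\<alpha>. 1 - 2 * \<alpha>)"
    by (intro bigoI[where c="2 * C + 1"]) (auto elim!: eventually_mono intro!: bound)
  then show ?thesis using eq by blast
qed

end
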